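(* Let $\Sigma^k$ be a properly immersed submanifold (with boundary) of the unit ball $B^n$ in $\mathbb{R}^n$. Then $\Sigma^k$ is a minimal submanifold which meets $\partial B^n$ orthogonally if and only if the coordinate functions of $\Sigma$ in $\mathbb{R}^n$ are eigenfunctions of the Dirichlet-to-Neumann map with eigenvalue one.
   Context: $\Sigma$ is compact $k$-dimensional with nonempty boundary, carries the metric induced from $\mathbb{R}^n$, and "properly immersed" includes $\partial\Sigma\subset\partial B^n$ (and interior points mapped to the interior of the ball). Let $\nu$ be the outward unit conormal along $\partial\Sigma$. $\Sigma$ meets $\partial B^n$ orthogonally if $\nu$ equals the position vector (the outward unit normal of $\partial B^n$) at each point of $\partial\Sigma$. The Dirichlet-to-Neumann map sends $u\in C^\infty(\partial\Sigma)$ to $\partial\hat u/\partial\nu$, with $\hat u$ the harmonic extension of $u$. The statement that the coordinate functions $x^1,\dots,x^n$ are eigenfunctions with eigenvalue one means that $\Delta_\Sigma x^i=0$ on $\Sigma$ and $\partial x^i/\partial\nu=x^i$ on $\partial\Sigma$ for $i=1,\dots,n$ (a coordinate function that vanishes identically on $\Sigma$ is allowed). *)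

theory Defs
  imports "HOL-Analysis.Analysis"
begin

section \<open>Smoothness on relatively open subsets of a half-space\<close>

text \<open>The model space is \<^term>\<open>half_space\<close>, cut out by a nonnegativity condition on one fixed
  coordinate; which coordinate plays this role is immaterial. The topological dimension is
  the cardinality of the index type.\<close>

definition bdry_ix :: "'k::finite" where
  "bdry_ix = (SOME i. True)"

definition half_space :: "(real^'k) set" where
  "half_space = {x. 0 \<le> x $ bdry_ix}"

primrec Ck_on :: "nat \<Rightarrow> (real^'k) set \<Rightarrow> (real^'k \<Rightarrow> 'b::real_normed_vector) \<Rightarrow> bool" where
  "Ck_on 0 = (\<lambda>W f. continuous_on W f)"
| "Ck_on (Suc m) = (\<lambda>W f. (\<forall>x\<in>W. f differentiable (at x)) \<and>
      (\<forall>v. Ck_on m W (\<lambda>x. frechet_derivative f (at x) v)))"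

text \<open>Smoothness up to the boundary: local existence of smooth extensions to open subsets of
  Euclidean space.\<close>

definition smooth_on :: "(real^'k) set \<Rightarrow> (real^'k \<Rightarrow> 'b::real_normed_vector) \<Rightarrow> bool" where
  "smooth_on S f \<longleftrightarrow> (\<forall>x\<in>S. \<exists>W h. open W \<and> x \<in> W \<and> (\<forall>m. Ck_on m W h) \<and> (\<forall>y\<in>S \<inter> W. h y = f y))"

text \<open>Partial derivatives are taken within \<open>S\<close>, hence one-sided in the transverse direction at
  points of the boundary hyperplane. For \<open>S\<close> relatively open in the half-space the Frechet
  derivative within \<open>S\<close> is unique.\<close>

definition pd :: "(real^'k) set \<Rightarrow> 'k \<Rightarrow> (real^'k \<Rightarrow> 'b::real_normed_vector) \<Rightarrow> real^'k \<Rightarrow> 'b" where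
  "pd S i f x = frechet_derivative f (at x within S) (axis i 1)"


section \<open>Manifolds with boundary\<close>

type_synonym ('a, 'k) chart = "'a set \<times> ('a \<Rightarrow> real^'k)"

definition chart_of :: "'a topology \<Rightarrow> ('a, 'k::finite) chart \<Rightarrow> bool" where
  "chart_of X \<kappa> \<longleftrightarrow> (case \<kappa> of (U, c) \<Rightarrow>
     openin X U \<and> openin (top_of_set half_space) (c ` U) \<and>
     homeomorphic_map (subtopology X U) (top_of_set (c ` U)) c)"

text \<open>\<open>A\<close> is a smooth atlas, not required to be maximal.\<close>

definition smooth_manifold_with_boundary :: "'a topology \<Rightarrow> ('a, 'k::finite) chart set \<Rightarrow> bool" where
  "smooth_manifold_with_boundary X A \<longleftrightarrow>
     Hausdorff_space X \<and> second_countable X \<and>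
     (\<forall>\<kappa>\<in>A. chart_of X \<kappa>) \<and> (\<Union>(U, c)\<in>A. U) = topspace X \<and>
     (\<forall>(U, c)\<in>A. \<forall>(V, d)\<in>A. smooth_on (c ` (U \<inter> V)) (d \<circ> inv_into U c))"

definition mfd_boundary :: "('a, 'k::finite) chart set \<Rightarrow> 'a set" where
  "mfd_boundary A = {p. \<exists>(U, c)\<in>A. p \<in> U \<and> c p $ bdry_ix = 0}"

definition smooth_function :: "('a, 'k::finite) chart set \<Rightarrow> ('a \<Rightarrow> real) \<Rightarrow> bool" where
  "smooth_function A u \<longleftrightarrow> (\<forall>(U, c)\<in>A. smooth_on (c ` U) (u \<circ> inv_into U c))"

definition smooth_immersion :: "('a, 'k::finite) chart set \<Rightarrow> ('a \<Rightarrow> real^'n) \<Rightarrow> bool" where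
  "smooth_immersion A \<phi> \<longleftrightarrow> (\<forall>(U, c)\<in>A. smooth_on (c ` U) (\<phi> \<circ> inv_into U c) \<and>
     (\<forall>x\<in>c ` U. inj (frechet_derivative (\<phi> \<circ> inv_into U c) (at x within c ` U))))"

text \<open>For compact \<open>X\<close> properness of the map is automatic.\<close>

definition properly_immersed_in_ball ::
    "'a topology \<Rightarrow> ('a, 'k::finite) chart set \<Rightarrow> ('a \<Rightarrow> real^'n) \<Rightarrow> bool" where
  "properly_immersed_in_ball X A \<phi> \<longleftrightarrow> smooth_immersion A \<phi> \<and>
     \<phi> ` mfd_boundary A \<subseteq> sphere 0 1 \<and> \<phi> ` (topspace X - mfd_boundary A) \<subseteq> ball 0 1"


section \<open>Riemannian geometry in a chart\<close>

text \<open>Here \<open>S\<close> is a relatively open subset of the half-space, \<open>g\<close> a Riemannian metric on \<open>S\<close> given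
  by its coefficient matrix, \<open>u\<close> a function on \<open>S\<close>, and \<open>F\<close> a local parametrization of an immersed
  submanifold.\<close>

definition induced_metric :: "(real^'k) set \<Rightarrow> (real^'k \<Rightarrow> real^'n) \<Rightarrow> real^'k \<Rightarrow> real^'k^'k" where
  "induced_metric S F x = (\<chi> i j. pd S i F x \<bullet> pd S j F x)"

definition christoffel ::
    "(real^'k) set \<Rightarrow> (real^'k \<Rightarrow> real^'k^'k) \<Rightarrow> real^'k \<Rightarrow> 'k \<Rightarrow> 'k \<Rightarrow> 'k \<Rightarrow> real" where
  "christoffel S g x l i j = (\<Sum>m\<in>UNIV. matrix_inv (g x) $ l $ m / 2 *
     (pd S i (\<lambda>y. g y $ j $ m) x + pd S j (\<lambda>y. g y $ i $ m) x - pd S m (\<lambda>y. g y $ i $ j) x))"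

text \<open>The components of the covariant Hessian \<open>\<nabla>du\<close> for the Levi-Civita connection; its
  metric trace is the Laplace-Beltrami operator \<open>div grad\<close>.\<close>

definition hessian ::
    "(real^'k) set \<Rightarrow> (real^'k \<Rightarrow> real^'k^'k) \<Rightarrow> (real^'k \<Rightarrow> real) \<Rightarrow> real^'k \<Rightarrow> 'k \<Rightarrow> 'k \<Rightarrow> real" where
  "hessian S g u x i j = pd S i (pd S j u) x - (\<Sum>l\<in>UNIV. christoffel S g x l i j * pd S l u x)"

definition laplace_beltrami ::
    "(real^'k) set \<Rightarrow> (real^'k \<Rightarrow> real^'k^'k) \<Rightarrow> (real^'k \<Rightarrow> real) \<Rightarrow> real^'k \<Rightarrow> real" where
  "laplace_beltrami S g u x =
     (\<Sum>i\<in>UNIV. \<Sum>j\<in>UNIV. matrix_inv (g x) $ i $ j * hessian S g u x i j)"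

text \<open>The component of \<open>w\<close> orthogonal to the subspace \<open>T\<close>.\<close>

definition normal_part :: "'b::real_inner set \<Rightarrow> 'b \<Rightarrow> 'b" where
  "normal_part T w = (THE z. w - z \<in> T \<and> (\<forall>t\<in>T. z \<bullet> t = 0))"

text \<open>The second fundamental form on the coordinate vector fields \<open>\<partial>\<^sub>i\<close>, \<open>\<partial>\<^sub>j\<close>: the normal part of
  the ambient covariant derivative, which in Euclidean space is the second partial derivative
  of \<open>F\<close>.\<close>

definition second_fundamental_form ::
    "(real^'k) set \<Rightarrow> (real^'k \<Rightarrow> real^'n) \<Rightarrow> real^'k \<Rightarrow> 'k \<Rightarrow> 'k \<Rightarrow> real^'n" where
  "second_fundamental_form S F x i j =
     normal_part (range (frechet_derivative F (at x within S))) (pd S i (pd S j F) x)"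

definition mean_curvature_vector ::
    "(real^'k) set \<Rightarrow> (real^'k \<Rightarrow> real^'n) \<Rightarrow> real^'k \<Rightarrow> real^'n" where
  "mean_curvature_vector S F x = (\<Sum>i\<in>UNIV. \<Sum>j\<in>UNIV.
     matrix_inv (induced_metric S F x) $ i $ j *\<^sub>R second_fundamental_form S F x i j)"

text \<open>At a point \<open>x\<close> of the boundary hyperplane: the coordinate representation of the outward unit
  conormal, i.e. the unit tangent vector that is orthogonal to the tangent space of the
  boundary (the vectors with vanishing \<^term>\<open>bdry_ix\<close>-component) and points out of the
  half-space.\<close>

definition outward_conormal :: "(real^'k \<Rightarrow> real^'k^'k) \<Rightarrow> real^'k \<Rightarrow> real^'k" where
  "outward_conormal g x = (THE v. v $ bdry_ix < 0 \<and> v \<bullet> (g x *v v) = 1 \<and>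
     (\<forall>w. w $ bdry_ix = 0 \<longrightarrow> w \<bullet> (g x *v v) = 0))"

definition conormal_derivative ::
    "(real^'k) set \<Rightarrow> (real^'k \<Rightarrow> real^'k^'k) \<Rightarrow> (real^'k \<Rightarrow> 'b::real_normed_vector) \<Rightarrow> real^'k \<Rightarrow> 'b" where
  "conormal_derivative S g f x = frechet_derivative f (at x within S) (outward_conormal g x)"


section \<open>Geometry of an immersed manifold\<close>

text \<open>The local expressions above are independent of the chart, so the conditions below are
  imposed in every chart of the atlas. \<open>\<phi>\<close> is the immersion, whose induced metric is used
  throughout.\<close>

definition chart_metric :: "('a \<Rightarrow> real^'n) \<Rightarrow> ('a, 'k::finite) chart \<Rightarrow> real^'k \<Rightarrow> real^'k^'k" where
  "chart_metric \<phi> = (\<lambda>(U, c). induced_metric (c ` U) (\<phi> \<circ> inv_into U c))"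

definition minimal_immersion :: "('a, 'k::finite) chart set \<Rightarrow> ('a \<Rightarrow> real^'n) \<Rightarrow> bool" where
  "minimal_immersion A \<phi> \<longleftrightarrow>
     (\<forall>(U, c)\<in>A. \<forall>p\<in>U. mean_curvature_vector (c ` U) (\<phi> \<circ> inv_into U c) (c p) = 0)"

text \<open>The conormal derivative of the immersion itself is the outward unit conormal \<open>\<nu>\<close>, regarded
  as a vector of the ambient space.\<close>

definition meets_sphere_orthogonally :: "('a, 'k::finite) chart set \<Rightarrow> ('a \<Rightarrow> real^'n) \<Rightarrow> bool" where
  "meets_sphere_orthogonally A \<phi> \<longleftrightarrow>
     (\<forall>(U, c)\<in>A. \<forall>p\<in>U. c p $ bdry_ix = 0 \<longrightarrow>
        conormal_derivative (c ` U) (chart_metric \<phi> (U, c)) (\<phi> \<circ> inv_into U c) (c p) = \<phi> p)"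

definition harmonic :: "('a, 'k::finite) chart set \<Rightarrow> ('a \<Rightarrow> real^'n) \<Rightarrow> ('a \<Rightarrow> real) \<Rightarrow> bool" where
  "harmonic A \<phi> u \<longleftrightarrow> smooth_function A u \<and>
     (\<forall>(U, c)\<in>A. \<forall>p\<in>U. laplace_beltrami (c ` U) (chart_metric \<phi> (U, c)) (u \<circ> inv_into U c) (c p) = 0)"

definition harmonic_extension ::
    "('a, 'k::finite) chart set \<Rightarrow> ('a \<Rightarrow> real^'n) \<Rightarrow> ('a \<Rightarrow> real) \<Rightarrow> ('a \<Rightarrow> real) \<Rightarrow> bool" where
  "harmonic_extension A \<phi> f u \<longleftrightarrow> harmonic A \<phi> u \<and> (\<forall>p\<in>mfd_boundary A. u p = f p)"

text \<open>The Dirichlet-to-Neumann map as a relation: it sends the boundary function \<open>f\<close> to the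
  boundary function \<open>h\<close>, through the harmonic extension \<open>u\<close> of \<open>f\<close>. Only the values of \<open>f\<close>
  and \<open>h\<close> on the boundary matter.\<close>

definition dirichlet_to_neumann ::
    "('a, 'k::finite) chart set \<Rightarrow> ('a \<Rightarrow> real^'n) \<Rightarrow> ('a \<Rightarrow> real) \<Rightarrow> ('a \<Rightarrow> real) \<Rightarrow> ('a \<Rightarrow> real) \<Rightarrow> bool" where
  "dirichlet_to_neumann A \<phi> f u h \<longleftrightarrow> harmonic_extension A \<phi> f u \<and>
     (\<forall>(U, c)\<in>A. \<forall>p\<in>U. c p $ bdry_ix = 0 \<longrightarrow>
        conormal_derivative (c ` U) (chart_metric \<phi> (U, c)) (u \<circ> inv_into U c) (c p) = h p)"

text \<open>A function \<open>u\<close> on the whole manifold is an eigenfunction if it is itself the harmonic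
  extension of its boundary values and the conormal derivative is \<open>lam * u\<close> on the boundary. The zero
  function is allowed.\<close>

definition dtn_eigenfunction ::
    "('a, 'k::finite) chart set \<Rightarrow> ('a \<Rightarrow> real^'n) \<Rightarrow> real \<Rightarrow> ('a \<Rightarrow> real) \<Rightarrow> bool" where
  "dtn_eigenfunction A \<phi> lam u \<longleftrightarrow> dirichlet_to_neumann A \<phi> u u (\<lambda>p. lam * u p)"

end

theory Submission
  imports Defs
begin

text \<open>Both sides of the equivalence are pointwise conditions in the charts, and they agree
  point by point.

  The interior condition is the identity \<open>\<Delta>\<^sub>\<Sigma> x\<^sup>a = H\<^sup>a\<close>: the Laplacian of a coordinate function
  of an immersion \<open>F\<close>, for the induced metric, is the corresponding component of the mean curvature
  vector. It is the metric trace of the Gauss formula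
  \<open>II(\<partial>\<^sub>i, \<partial>\<^sub>j) = \<partial>\<^sub>i \<partial>\<^sub>j F - \<Gamma>\<^sup>l\<^sub>i\<^sub>j \<partial>\<^sub>l F\<close> (\<open>second_fundamental_form_eq\<close>), whose right-hand side has the
  Hessians of the coordinate functions as its components. To prove the Gauss formula one
  differentiates \<open>g\<^sub>j\<^sub>m = \<langle>\<partial>\<^sub>j F, \<partial>\<^sub>m F\<rangle>\<close>; since second derivatives commute, the combination of metric
  derivatives in the Christoffel symbols collapses to \<open>2 \<langle>\<partial>\<^sub>i \<partial>\<^sub>j F, \<partial>\<^sub>m F\<rangle>\<close>. So \<open>\<Gamma>\<^sup>l\<^sub>i\<^sub>j\<close> are the
  coefficients of the orthogonal projection of \<open>\<partial>\<^sub>i \<partial>\<^sub>j F\<close> to the tangent space, and subtracting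
  this projection leaves the normal part.

  The boundary condition is immediate: the \<open>a\<close>-th component of the conormal derivative of \<open>F\<close> is the
  conormal derivative of the \<open>a\<close>-th coordinate function, so orthogonality \<open>\<nu> = x\<close> says
  that \<open>\<partial>x\<^sup>a/\<partial>\<nu> = x\<^sup>a\<close> for every \<open>a\<close>.

  The analytic work is to justify calculus with one-sided derivatives at boundary points. There
  every derivative within the half-space is the derivative of a smooth local extension, which
  reduces the symmetry of second derivatives to the case of an open set.\<close>

section \<open>Symmetry of second derivatives\<close>

text \<open>The second difference of \<open>f\<close> over a parallelogram is a value of the mixed second derivative:
  the mean value theorem is applied first to the difference in direction \<open>w\<close> as a function of the
  displacement along \<open>v\<close>, and then to the derivative \<open>fv\<close> along \<open>w\<close>.\<close>

lemma second_difference_mean_value: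
  fixes f fv fvw :: "'a::real_normed_vector \<Rightarrow> real"
  assumes "0 < t"
    and para: "\<And>a b. 0 \<le> a \<Longrightarrow> a \<le> t \<Longrightarrow> 0 \<le> b \<Longrightarrow> b \<le> t \<Longrightarrow> x + a *\<^sub>R v + b *\<^sub>R w \<in> W"
    and f: "\<And>y. y \<in> W \<Longrightarrow> (f has_derivative f' y) (at y)"
    and f'v: "\<And>y. y \<in> W \<Longrightarrow> f' y v = fv y"
    and fv: "\<And>y. y \<in> W \<Longrightarrow> (fv has_derivative fv' y) (at y)"
    and fv'w: "\<And>y. y \<in> W \<Longrightarrow> fv' y w = fvw y"
  shows "\<exists>a b. 0 < a \<and> a < t \<and> 0 < b \<and> b < t \<and>
    f (x + t *\<^sub>R v + t *\<^sub>R w) - f (x + t *\<^sub>R v) - f (x + t *\<^sub>R w) + f x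
      = t * t * fvw (x + a *\<^sub>R v + b *\<^sub>R w)"
proof -
  have df: "((\<lambda>s. f (x + s *\<^sub>R v + b *\<^sub>R w)) has_derivative
      (\<lambda>h. h * fv (x + s *\<^sub>R v + b *\<^sub>R w))) (at s)"
    if "0 \<le> s" "s \<le> t" "0 \<le> b" "b \<le> t" for s b
  proof -
    have "((\<lambda>s. x + s *\<^sub>R v + b *\<^sub>R w) has_derivative (\<lambda>h. h *\<^sub>R v)) (at s)"
      by (auto intro!: derivative_eq_intros)
    from has_derivative_compose[OF this f[OF para[OF that]]]
    show ?thesis
      using has_derivative_bounded_linear[OF f[OF para[OF that]]] f'v[OF para[OF that]]
      by (simp add: linear_simps(5))
  qed
  have dfv: "((\<lambda>s. fv (x + a *\<^sub>R v + s *\<^sub>R w)) has_derivative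
      (\<lambda>h. h * fvw (x + a *\<^sub>R v + s *\<^sub>R w))) (at s)"
    if "0 \<le> a" "a \<le> t" "0 \<le> s" "s \<le> t" for s a
  proof -
    have "((\<lambda>s. x + a *\<^sub>R v + s *\<^sub>R w) has_derivative (\<lambda>h. h *\<^sub>R w)) (at s)"
      by (auto intro!: derivative_eq_intros)
    from has_derivative_compose[OF this fv[OF para[OF that]]]
    show ?thesis
      using has_derivative_bounded_linear[OF fv[OF para[OF that]]] fv'w[OF para[OF that]]
      by (simp add: linear_simps(5))
  qed
  let ?G = "\<lambda>s. f (x + s *\<^sub>R v + t *\<^sub>R w) - f (x + s *\<^sub>R v + 0 *\<^sub>R w)"
  let ?G' = "\<lambda>s h. h * fv (x + s *\<^sub>R v + t *\<^sub>R w) - h * fv (x + s *\<^sub>R v + 0 *\<^sub>R w)"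
  have G: "(?G has_derivative ?G' s) (at s within {0..t})" if "0 \<le> s" "s \<le> t" for s
    using has_derivative_at_withinI[OF has_derivative_diff[OF df[of s t] df[of s 0]]] that \<open>0 < t\<close>
    by simp
  obtain a where a: "a \<in> {0<..<t}" "?G t - ?G 0 = ?G' a (t - 0)"
    using mvt_simple[OF \<open>0 < t\<close> G] by blast
  let ?K = "\<lambda>s. fv (x + a *\<^sub>R v + s *\<^sub>R w)"
  let ?K' = "\<lambda>s h. h * fvw (x + a *\<^sub>R v + s *\<^sub>R w)"
  have K: "(?K has_derivative ?K' s) (at s within {0..t})" if "0 \<le> s" "s \<le> t" for s
    using has_derivative_at_withinI[OF dfv[of a s]] that a(1) by simp
  obtain b where b: "b \<in> {0<..<t}" "?K t - ?K 0 = ?K' b (t - 0)"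
    using mvt_simple[OF \<open>0 < t\<close> K] by blast
  have "?G t - ?G 0 = t * (?K t - ?K 0)"
    using a(2) by (simp add: algebra_simps)
  also have "\<dots> = t * t * fvw (x + a *\<^sub>R v + b *\<^sub>R w)"
    using b(2) by simp
  finally show ?thesis
    using a(1) b(1) by (intro exI[of _ a] exI[of _ b]) (auto simp: algebra_simps)
qed

text \<open>The second difference does not change when the two directions are exchanged, so the two mixed
  derivatives have a common value, taken at possibly different points arbitrarily close to \<open>x\<close>;
  continuity gives equality at \<open>x\<close>.\<close>

lemma mixed_derivatives_commute_real:
  fixes f fv fw fvw fwv :: "'a::real_normed_vector \<Rightarrow> real"
  assumes "open W" "x \<in> W"
    and f: "\<And>y. y \<in> W \<Longrightarrow> (f has_derivative f' y) (at y)"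
    and "\<And>y. y \<in> W \<Longrightarrow> f' y v = fv y" "\<And>y. y \<in> W \<Longrightarrow> f' y w = fw y"
    and "\<And>y. y \<in> W \<Longrightarrow> (fv has_derivative fv' y) (at y)"
    and "\<And>y. y \<in> W \<Longrightarrow> (fw has_derivative fw' y) (at y)"
    and "\<And>y. y \<in> W \<Longrightarrow> fv' y w = fvw y" "\<And>y. y \<in> W \<Longrightarrow> fw' y v = fwv y"
    and cont: "continuous_on W fvw" "continuous_on W fwv"
  shows "fvw x = fwv x"
proof (rule ccontr)
  assume ne: "fvw x \<noteq> fwv x"
  let ?e = "dist (fvw x) (fwv x) / 2"
  have "0 < ?e" using ne by simp
  then obtain d1 where d1: "0 < d1" "\<And>y. y \<in> W \<Longrightarrow> dist y x < d1 \<Longrightarrow> dist (fvw y) (fvw x) < ?e"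
    using cont(1) \<open>x \<in> W\<close> unfolding continuous_on_iff by meson
  from \<open>0 < ?e\<close> obtain d2 where d2: "0 < d2" "\<And>y. y \<in> W \<Longrightarrow> dist y x < d2 \<Longrightarrow> dist (fwv y) (fwv x) < ?e"
    using cont(2) \<open>x \<in> W\<close> unfolding continuous_on_iff by meson
  obtain d3 where d3: "0 < d3" "ball x d3 \<subseteq> W"
    using \<open>open W\<close> \<open>x \<in> W\<close> open_contains_ball by blast
  define d where "d = min d1 (min d2 d3)"
  have "0 < d" using d1 d2 d3 by (simp add: d_def)
  define t where "t = d / (norm v + norm w + 1)"
  have "0 < norm v + norm w + 1"
    by (simp add: add_nonneg_pos)
  then have t: "0 < t" "t * (norm v + norm w) < d"
    using \<open>0 < d\<close> by (auto simp: t_def field_simps)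
  have close: "dist (x + a *\<^sub>R v + b *\<^sub>R w) x < d"
    if "0 \<le> a" "a \<le> t" "0 \<le> b" "b \<le> t" for a b
  proof -
    have "norm (a *\<^sub>R v + b *\<^sub>R w) \<le> a * norm v + b * norm w"
      using norm_triangle_ineq[of "a *\<^sub>R v" "b *\<^sub>R w"] that by simp
    also have "\<dots> \<le> t * norm v + t * norm w"
      using that by (intro add_mono mult_right_mono) auto
    also have "\<dots> < d" using t by (simp add: algebra_simps)
    finally show ?thesis by (simp add: dist_norm add.assoc)
  qed
  have inW: "x + a *\<^sub>R v + b *\<^sub>R w \<in> W"
    if "0 \<le> a" "a \<le> t" "0 \<le> b" "b \<le> t" for a b
    using close[OF that] d3 by (auto simp: d_def dist_commute)
  have inW': "x + b *\<^sub>R w + a *\<^sub>R v \<in> W"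
    if "0 \<le> b" "b \<le> t" "0 \<le> a" "a \<le> t" for a b
    using inW[of a b] that by (simp add: add.assoc add.commute[of "b *\<^sub>R w"])
  obtain a b where ab: "0 < a" "a < t" "0 < b" "b < t"
    "f (x + t *\<^sub>R v + t *\<^sub>R w) - f (x + t *\<^sub>R v) - f (x + t *\<^sub>R w) + f x
      = t * t * fvw (x + a *\<^sub>R v + b *\<^sub>R w)"
    using second_difference_mean_value[OF t(1) inW f assms(4) assms(6) assms(8)] by blast
  obtain a' b' where ab': "0 < b'" "b' < t" "0 < a'" "a' < t"
    "f (x + t *\<^sub>R w + t *\<^sub>R v) - f (x + t *\<^sub>R w) - f (x + t *\<^sub>R v) + f x
      = t * t * fwv (x + b' *\<^sub>R w + a' *\<^sub>R v)"
    using second_difference_mean_value[OF t(1) inW' f assms(5) assms(7) assms(9)] by blast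
  have swap: "x + r *\<^sub>R w + s *\<^sub>R v = x + s *\<^sub>R v + r *\<^sub>R w" for r s
    by simp
  have eq: "fvw (x + a *\<^sub>R v + b *\<^sub>R w) = fwv (x + a' *\<^sub>R v + b' *\<^sub>R w)" (is "?p = ?q")
  proof -
    have "t * t * ?p = t * t * ?q"
      using ab(5) ab'(5) unfolding swap by linarith
    then show ?thesis using t(1) by simp
  qed
  have "dist ?p (fvw x) < ?e"
    using ab inW[of a b] close[of a b] by (intro d1(2)) (auto simp: d_def)
  moreover have "dist ?p (fwv x) < ?e"
    unfolding eq using ab' inW[of a' b'] close[of a' b'] by (intro d2(2)) (auto simp: d_def)
  ultimately show False
    using dist_triangle3[of "fvw x" "fwv x" ?p] by linarith
qed

lemma Ck_on_cong:
  assumes "open W" "\<And>x. x \<in> W \<Longrightarrow> f x = g x" "Ck_on m W f"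
  shows "Ck_on m W g"
  using assms(2,3)
proof (induction m arbitrary: f g)
  case 0
  then show ?case using continuous_on_cong[of W W f g] by simp
next
  case (Suc m)
  have diff: "f differentiable (at x)" if "x \<in> W" for x
    using Suc.prems(2) that by simp
  have "g differentiable (at x)" if "x \<in> W" for x
    using diff[OF that] has_derivative_transform_within_open[OF _ \<open>open W\<close> that] Suc.prems(1)
    unfolding differentiable_def by blast
  moreover have "Ck_on m W (\<lambda>x. frechet_derivative g (at x) v)" for v
  proof (rule Suc.IH)
    show "frechet_derivative f (at x) v = frechet_derivative g (at x) v" if "x \<in> W" for x
      using frechet_derivative_transform_within_open[OF diff[OF that] \<open>open W\<close> that] Suc.prems(1)
      by simp
    show "Ck_on m W (\<lambda>x. frechet_derivative f (at x) v)"
      using Suc.prems(2) by simp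
  qed
  ultimately show ?case by simp
qed

lemma frechet_derivative_bounded_linear:
  assumes "bounded_linear T" "f differentiable (at x)"
  shows "frechet_derivative (\<lambda>x. T (f x)) (at x) v = T (frechet_derivative f (at x) v)"
  using frechet_derivative_at[OF bounded_linear.has_derivative[OF assms(1)
        frechet_derivative_works[THEN iffD1, OF assms(2)]]]
  by metis

lemma Ck_on_bounded_linear:
  assumes "open W" "bounded_linear T" "Ck_on m W f"
  shows "Ck_on m W (\<lambda>x. T (f x))"
  using assms(3)
proof (induction m arbitrary: f)
  case 0
  then show ?case
    using bounded_linear.continuous_on[OF assms(2)] by simp
next
  case (Suc m)
  have diff: "f differentiable (at x)" if "x \<in> W" for x
    using Suc.prems that by simp
  have "(\<lambda>x. T (f x)) differentiable (at x)" if "x \<in> W" for x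
    using bounded_linear.has_derivative[OF assms(2)] diff[OF that]
    unfolding differentiable_def by blast
  moreover have "Ck_on m W (\<lambda>x. frechet_derivative (\<lambda>x. T (f x)) (at x) v)" for v
  proof (rule Ck_on_cong[OF assms(1)])
    show "Ck_on m W (\<lambda>x. T (frechet_derivative f (at x) v))"
      using Suc by simp
  qed (simp add: frechet_derivative_bounded_linear[OF assms(2)] diff)
  ultimately show ?case by simp
qed

lemma Ck_on_mixed_derivatives_commute:
  fixes h :: "real^'k \<Rightarrow> real^'n"
  assumes "open W" "x \<in> W" and C2: "Ck_on (Suc (Suc 0)) W h"
  shows "frechet_derivative (\<lambda>y. frechet_derivative h (at y) v) (at x) w
       = frechet_derivative (\<lambda>y. frechet_derivative h (at y) w) (at x) v"
proof -
  have diff: "h differentiable (at y)" if "y \<in> W" for y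
    using C2 that by simp
  have diff2: "(\<lambda>z. frechet_derivative h (at z) u) differentiable (at y)" if "y \<in> W" for y u
    using C2 that by simp
  have cont: "continuous_on W (\<lambda>y. frechet_derivative (\<lambda>z. frechet_derivative h (at z) u) (at y) u')" for u u'
    using C2 by simp
  have "frechet_derivative (\<lambda>y. frechet_derivative h (at y) v) (at x) w $ a
      = frechet_derivative (\<lambda>y. frechet_derivative h (at y) w) (at x) v $ a" for a
  proof (rule mixed_derivatives_commute_real[OF assms(1,2)])
    let ?D = "\<lambda>y u. frechet_derivative h (at y) u $ a"
    show "((\<lambda>y. h y $ a) has_derivative ?D y) (at y)" if "y \<in> W" for y
      by (rule bounded_linear.has_derivative[OF bounded_linear_vec_nth])
        (rule frechet_derivative_works[THEN iffD1, OF diff[OF that]])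
    show "((\<lambda>y. ?D y v) has_derivative
        (\<lambda>u. frechet_derivative (\<lambda>y. frechet_derivative h (at y) v) (at y) u $ a)) (at y)"
      "((\<lambda>y. ?D y w) has_derivative
        (\<lambda>u. frechet_derivative (\<lambda>y. frechet_derivative h (at y) w) (at y) u $ a)) (at y)"
      if "y \<in> W" for y
      by (rule bounded_linear.has_derivative[OF bounded_linear_vec_nth],
          rule frechet_derivative_works[THEN iffD1, OF diff2[OF that]])+
  qed (auto intro!: continuous_intros cont)
  then show ?thesis by (simp add: vec_eq_iff)
qed


section \<open>One-sided derivatives on relatively open subsets of the half-space\<close>

text \<open>From every point of \<open>S\<close> one can move a little in each positive coordinate direction without
  leaving \<open>S\<close>, so there are enough directions to determine a linear map.\<close>

lemma has_derivative_within_half_space_unique: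
  fixes f :: "real^'k \<Rightarrow> 'b::real_normed_vector"
  assumes S: "openin (top_of_set half_space) S" and x: "x \<in> S"
    and "(f has_derivative f') (at x within S)" "(f has_derivative f'') (at x within S)"
  shows "f' = f''"
proof (rule frechet_derivative_unique_within[OF assms(3,4)])
  fix i :: "real^'k" and e :: real
  assume i: "i \<in> Basis" and e: "0 < e"
  obtain d where d: "0 < d" "ball x d \<inter> half_space \<subseteq> S"
    using S x by (auto simp: openin_contains_ball)
  define s where "s = min d e / 2"
  have s: "0 < s" "s < d" "s < e"
    using d e by (auto simp: s_def min_def)
  have "x \<in> half_space"
    using S x openin_imp_subset by blast
  moreover have "0 \<le> i $ bdry_ix"
    using i by (auto simp: Basis_vec_def axis_def)
  ultimately have "x + s *\<^sub>R i \<in> half_space"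
    using s by (simp add: half_space_def)
  moreover have "x + s *\<^sub>R i \<in> ball x d"
    using s i by (simp add: dist_norm)
  ultimately show "\<exists>d. 0 < \<bar>d\<bar> \<and> \<bar>d\<bar> < e \<and> x + d *\<^sub>R i \<in> S"
    using s d by (intro exI[of _ s]) auto
qed

lemma frechet_derivative_within_half_space:
  fixes f :: "real^'k \<Rightarrow> 'b::real_normed_vector"
  assumes "openin (top_of_set half_space) S" "x \<in> S"
    and "(f has_derivative f') (at x within S)"
  shows "frechet_derivative f (at x within S) = f'"
  using has_derivative_within_half_space_unique[OF assms(1,2) _ assms(3)] assms(3)
  by (metis differentiableI frechet_derivative_works)

lemma pd_eq:
  fixes f :: "real^'k \<Rightarrow> 'b::real_normed_vector"
  assumes "openin (top_of_set half_space) S" "x \<in> S"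
    and "(f has_derivative f') (at x within S)"
  shows "pd S i f x = f' (axis i 1)"
  by (simp add: pd_def frechet_derivative_within_half_space[OF assms])

lemma pd_cong:
  assumes "\<And>y. y \<in> S \<Longrightarrow> f y = g y" "x \<in> S"
  shows "pd S i f x = pd S i g x"
proof -
  have "(f has_derivative D) (at x within S) \<longleftrightarrow> (g has_derivative D) (at x within S)" for D
    using has_derivative_transform[OF assms(2)] assms(1) by metis
  then show ?thesis by (simp add: pd_def frechet_derivative_def)
qed

lemma pd_bounded_linear:
  fixes f :: "real^'k \<Rightarrow> 'b::real_normed_vector"
  assumes "openin (top_of_set half_space) S" "x \<in> S" "bounded_linear T"
    and "f differentiable (at x within S)"
  shows "pd S i (\<lambda>y. T (f y)) x = T (pd S i f x)"
  using pd_eq[OF assms(1,2) bounded_linear.has_derivative[OF assms(3)]]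
    frechet_derivative_works[THEN iffD1, OF assms(4)]
  unfolding pd_def[of S i f x] by blast

lemma has_derivative_within_extension:
  assumes "x \<in> S" "open W" "x \<in> W" "h differentiable (at x)" "\<forall>y\<in>S \<inter> W. h y = f y"
  shows "(f has_derivative frechet_derivative h (at x)) (at x within S)"
proof -
  have "(h has_derivative frechet_derivative h (at x)) (at x within S \<inter> W)"
    using frechet_derivative_works[THEN iffD1, OF assms(4)] by (rule has_derivative_at_withinI)
  then have "(f has_derivative frechet_derivative h (at x)) (at x within S \<inter> W)"
    by (rule has_derivative_transform[rotated 2]) (use assms(1,3,5) in auto)
  then show ?thesis
    using at_within_nhd[of x W "S \<inter> W" S] assms(2,3) by (simp add: Int_ac)
qed

lemma pd_extension:
  fixes f :: "real^'k \<Rightarrow> 'b::real_normed_vector"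
  assumes "openin (top_of_set half_space) S"
    and "x \<in> S" "open W" "x \<in> W" "h differentiable (at x)" "\<forall>y\<in>S \<inter> W. h y = f y"
  shows "pd S i f x = frechet_derivative h (at x) (axis i 1)"
  using pd_eq[OF assms(1,2) has_derivative_within_extension[OF assms(2-6)]] .

lemma smooth_on_differentiable:
  assumes "smooth_on S f" "x \<in> S"
  shows "f differentiable (at x within S)"
proof -
  obtain W h where W: "open W" "x \<in> W" "\<forall>m. Ck_on m W h" "\<forall>y\<in>S \<inter> W. h y = f y"
    using assms unfolding smooth_on_def by blast
  have "Ck_on (Suc 0) W h" using W(3) by blast
  then have "h differentiable (at x)" using W(2) by simp
  then show ?thesis
    using has_derivative_within_extension[OF assms(2) W(1,2) _ W(4)] differentiableI by blast
qed

lemma smooth_on_bounded_linear: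
  assumes "smooth_on S f" "bounded_linear T"
  shows "smooth_on S (\<lambda>x. T (f x))"
  unfolding smooth_on_def
proof
  fix x assume "x \<in> S"
  then obtain W h where W: "open W" "x \<in> W" "\<And>m. Ck_on m W h" "\<forall>y\<in>S \<inter> W. h y = f y"
    using assms(1) unfolding smooth_on_def by blast
  then show "\<exists>W h. open W \<and> x \<in> W \<and> (\<forall>m. Ck_on m W h) \<and> (\<forall>y\<in>S \<inter> W. h y = T (f y))"
    using Ck_on_bounded_linear[OF W(1) assms(2) W(3)]
    by (intro exI[of _ W] exI[of _ "\<lambda>x. T (h x)"]) auto
qed

lemma smooth_on_pd:
  fixes f :: "real^'k \<Rightarrow> 'b::real_normed_vector"
  assumes S: "openin (top_of_set half_space) S" and "smooth_on S f"
  shows "smooth_on S (pd S i f)"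
  unfolding smooth_on_def
proof
  fix x assume "x \<in> S"
  then obtain W h where W: "open W" "x \<in> W" "\<And>m. Ck_on m W h" "\<forall>y\<in>S \<inter> W. h y = f y"
    using assms(2) unfolding smooth_on_def by blast
  let ?k = "\<lambda>y. frechet_derivative h (at y) (axis i 1)"
  have "Ck_on m W ?k" for m
    using W(3)[of "Suc m"] by simp
  moreover have "?k y = pd S i f y" if "y \<in> S \<inter> W" for y
    using pd_extension[OF S _ W(1) _ _ W(4), of y] that W(3)[of "Suc 0"] by auto
  ultimately show "\<exists>W h. open W \<and> x \<in> W \<and> (\<forall>m. Ck_on m W h) \<and> (\<forall>y\<in>S \<inter> W. h y = pd S i f y)"
    using W(1,2) by blast
qed

lemma pd_commute:
  fixes F :: "real^'k \<Rightarrow> real^'n"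
  assumes S: "openin (top_of_set half_space) S" and "smooth_on S F" and x: "x \<in> S"
  shows "pd S i (pd S j F) x = pd S j (pd S i F) x"
proof -
  obtain W h where W: "open W" "x \<in> W" "\<And>m. Ck_on m W h" "\<forall>y\<in>S \<inter> W. h y = F y"
    using assms(2) x unfolding smooth_on_def by blast
  let ?k = "\<lambda>i y. frechet_derivative h (at y) (axis i 1)"
  have C2: "Ck_on (Suc (Suc 0)) W h" using W(3) .
  have "\<forall>y\<in>S \<inter> W. ?k i y = pd S i F y" for i
    using pd_extension[OF S _ W(1) _ _ W(4)] C2 by auto
  then have "pd S j (pd S i F) x = frechet_derivative (?k i) (at x) (axis j 1)" for i j
    using C2 W(2) by (intro pd_extension[OF S x W(1,2)]) auto
  then show ?thesis
    using Ck_on_mixed_derivatives_commute[OF W(1,2) C2] by simp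
qed


section \<open>The Gauss formula\<close>

lemma normal_part_eqI:
  assumes "subspace T" "w - z \<in> T" "\<And>t. t \<in> T \<Longrightarrow> z \<bullet> t = 0"
  shows "normal_part T w = z"
  unfolding normal_part_def
proof (rule the_equality)
  fix z' assume z': "w - z' \<in> T \<and> (\<forall>t\<in>T. z' \<bullet> t = 0)"
  then have "(w - z) - (w - z') \<in> T"
    using assms(1,2) subspace_diff by blast
  then have "z' - z \<in> T" by simp
  then have "(z' - z) \<bullet> (z' - z) = 0"
    using z' assms(3) by (simp add: inner_diff_left)
  then show "z' = z" by simp
qed (use assms in blast)

lemma frechet_derivative_eq_sum_pd:
  fixes F :: "real^'k \<Rightarrow> 'b::real_normed_vector"
  assumes "F differentiable (at x within S)"
  shows "frechet_derivative F (at x within S) v = (\<Sum>l\<in>UNIV. (v $ l) *\<^sub>R pd S l F x)"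
proof -
  have "linear (frechet_derivative F (at x within S))"
    using linear_frechet_derivative[OF assms] .
  then have "frechet_derivative F (at x within S) (\<Sum>l\<in>UNIV. (v $ l) *\<^sub>R axis l 1)
      = (\<Sum>l\<in>UNIV. (v $ l) *\<^sub>R pd S l F x)"
    by (simp add: linear_sum linear_scale pd_def)
  moreover have "(\<Sum>l\<in>UNIV. (v $ l) *\<^sub>R axis l 1) = v"
    using basis_expansion[of v] by (simp add: scalar_mult_eq_scaleR)
  ultimately show ?thesis by simp
qed

text \<open>The Gram matrix of linearly independent vectors is invertible, because \<open>v \<bullet> g v = \<bar>DF v\<bar>\<^sup>2\<close>.\<close>

lemma induced_metric_inverse:
  fixes F :: "real^'k \<Rightarrow> real^'n"
  assumes diff: "F differentiable (at x within S)"
    and inj: "inj (frechet_derivative F (at x within S))"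
  shows "induced_metric S F x ** matrix_inv (induced_metric S F x) = mat 1"
proof -
  let ?g = "induced_metric S F x" and ?D = "frechet_derivative F (at x within S)"
  have "v = 0" if "?g *v v = 0" for v
  proof -
    have "?D v \<bullet> ?D v = v \<bullet> (?g *v v)"
      by (simp add: frechet_derivative_eq_sum_pd[OF diff] inner_vec_def[of v]
          matrix_vector_mult_def induced_metric_def inner_sum_left inner_sum_right sum_distrib_left
          mult_ac inner_commute)
    then have "?D v = 0" using that by simp
    then show "v = 0"
      using inj linear_injective_0[OF linear_frechet_derivative[OF diff]] by blast
  qed
  then have "invertible ?g"
    using matrix_left_invertible_ker invertible_left_inverse by blast
  then show ?thesis
    unfolding invertible_def matrix_inv_def by (rule someI2_ex) simp
qed

lemma pd_induced_metric:
  fixes F :: "real^'k \<Rightarrow> real^'n"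
  assumes S: "openin (top_of_set half_space) S" and F: "smooth_on S F" and x: "x \<in> S"
  shows "pd S i (\<lambda>y. induced_metric S F y $ j $ m) x
    = pd S j F x \<bullet> pd S i (pd S m F) x + pd S i (pd S j F) x \<bullet> pd S m F x"
proof -
  have "(pd S l F has_derivative frechet_derivative (pd S l F) (at x within S)) (at x within S)" for l
    using smooth_on_differentiable[OF smooth_on_pd[OF S F] x] frechet_derivative_works by blast
  from pd_eq[OF S x has_derivative_inner[OF this this]]
  show ?thesis
    by (simp add: induced_metric_def pd_def[of S i "pd S _ F"])
qed

text \<open>The combination of metric derivatives in the Christoffel symbol of the first kind is
  \<open>2 \<langle>\<partial>\<^sub>i \<partial>\<^sub>j F, \<partial>\<^sub>m F\<rangle>\<close>: by the product rule and the symmetry of second derivatives, the other four of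
  the six terms cancel in pairs.\<close>

lemma christoffel_induced_metric:
  fixes F :: "real^'k \<Rightarrow> real^'n"
  assumes S: "openin (top_of_set half_space) S" and F: "smooth_on S F" and x: "x \<in> S"
  shows "christoffel S (induced_metric S F) x l i j
    = (\<Sum>m\<in>UNIV. matrix_inv (induced_metric S F x) $ l $ m * (pd S i (pd S j F) x \<bullet> pd S m F x))"
proof -
  have "pd S i (\<lambda>y. induced_metric S F y $ j $ m) x + pd S j (\<lambda>y. induced_metric S F y $ i $ m) x
      - pd S m (\<lambda>y. induced_metric S F y $ i $ j) x = 2 * (pd S i (pd S j F) x \<bullet> pd S m F x)" for m
    unfolding pd_induced_metric[OF assms]
    using pd_commute[OF assms, of j i] pd_commute[OF assms, of m i] pd_commute[OF assms, of m j]
    by (simp add: inner_commute)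
  then show ?thesis by (simp add: christoffel_def)
qed

text \<open>The vectors \<open>\<Gamma>\<^sup>l\<^sub>i\<^sub>j \<partial>\<^sub>l F\<close> add up to the tangential part of \<open>\<partial>\<^sub>i \<partial>\<^sub>j F\<close>, since pairing the sum with
  \<open>\<partial>\<^sub>p F\<close> multiplies the inverse metric in \<open>\<Gamma>\<^sup>l\<^sub>i\<^sub>j\<close> by the metric and leaves \<open>\<langle>\<partial>\<^sub>i \<partial>\<^sub>j F, \<partial>\<^sub>p F\<rangle>\<close>.\<close>

lemma second_fundamental_form_eq:
  fixes F :: "real^'k \<Rightarrow> real^'n"
  assumes S: "openin (top_of_set half_space) S" and F: "smooth_on S F" and x: "x \<in> S"
    and inj: "inj (frechet_derivative F (at x within S))"
  shows "second_fundamental_form S F x i j = pd S i (pd S j F) x -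
    (\<Sum>l\<in>UNIV. christoffel S (induced_metric S F) x l i j *\<^sub>R pd S l F x)"
  unfolding second_fundamental_form_def
proof (rule normal_part_eqI)
  let ?D = "frechet_derivative F (at x within S)"
  let ?g = "induced_metric S F x" and ?h = "matrix_inv (induced_metric S F x)"
  let ?\<Gamma> = "\<lambda>l. christoffel S (induced_metric S F) x l i j"
  let ?w = "pd S i (pd S j F) x"
  let ?z = "?w - (\<Sum>l\<in>UNIV. ?\<Gamma> l *\<^sub>R pd S l F x)"
  have diff: "F differentiable (at x within S)"
    by (rule smooth_on_differentiable[OF F x])
  show "subspace (range ?D)"
    by (rule linear_subspace_image[OF linear_frechet_derivative[OF diff] subspace_UNIV])
  have "?w - ?z = ?D (\<chi> l. ?\<Gamma> l)"
    by (simp add: frechet_derivative_eq_sum_pd[OF diff])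
  then show "?w - ?z \<in> range ?D" by blast
  have g: "pd S l F x \<bullet> pd S p F x = ?g $ p $ l" for l p
    by (simp add: induced_metric_def inner_commute)
  have gh: "(\<Sum>l\<in>UNIV. ?g $ p $ l * ?h $ l $ m) = (if p = m then 1 else 0)" for p m
    using arg_cong[OF induced_metric_inverse[OF diff inj], of "\<lambda>M. M $ p $ m"]
    by (simp add: matrix_matrix_mult_def mat_def)
  have orth: "?z \<bullet> pd S p F x = 0" for p
  proof -
    have "(\<Sum>l\<in>UNIV. ?\<Gamma> l *\<^sub>R pd S l F x) \<bullet> pd S p F x
        = (\<Sum>l\<in>UNIV. \<Sum>m\<in>UNIV. ?g $ p $ l * ?h $ l $ m * (?w \<bullet> pd S m F x))"
      by (simp add: christoffel_induced_metric[OF S F x] inner_sum_left sum_distrib_right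
          g sum_distrib_left mult_ac)
    also have "\<dots> = (\<Sum>m\<in>UNIV. (\<Sum>l\<in>UNIV. ?g $ p $ l * ?h $ l $ m) * (?w \<bullet> pd S m F x))"
      unfolding sum_distrib_right by (rule sum.swap)
    also have "\<dots> = ?w \<bullet> pd S p F x"
      by (simp add: gh if_distrib[of "\<lambda>a. a * _"] cong: if_cong)
    finally show ?thesis by (simp add: inner_diff_left)
  qed
  show "?z \<bullet> t = 0" if "t \<in> range ?D" for t
    using that orth by (auto simp: frechet_derivative_eq_sum_pd[OF diff] inner_sum_right)
qed

lemma hessian_component:
  fixes F :: "real^'k \<Rightarrow> real^'n"
  assumes S: "openin (top_of_set half_space) S" and F: "smooth_on S F" and x: "x \<in> S"
  shows "hessian S g (\<lambda>y. F y $ a) x i j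
    = (pd S i (pd S j F) x - (\<Sum>l\<in>UNIV. christoffel S g x l i j *\<^sub>R pd S l F x)) $ a"
proof -
  have first: "pd S l (\<lambda>y. F y $ a) y = pd S l F y $ a" if "y \<in> S" for l y
    by (rule pd_bounded_linear[OF S that bounded_linear_vec_nth smooth_on_differentiable[OF F that]])
  have "pd S i (pd S j (\<lambda>y. F y $ a)) x = pd S i (\<lambda>y. pd S j F y $ a) x"
    by (rule pd_cong[OF first x])
  also have "\<dots> = pd S i (pd S j F) x $ a"
    by (rule pd_bounded_linear[OF S x bounded_linear_vec_nth
          smooth_on_differentiable[OF smooth_on_pd[OF S F] x]])
  finally show ?thesis
    by (simp add: hessian_def first[OF x])
qed

lemma mean_curvature_component_eq_laplacian:
  fixes F :: "real^'k \<Rightarrow> real^'n"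
  assumes "openin (top_of_set half_space) S" "smooth_on S F" "x \<in> S"
    and "inj (frechet_derivative F (at x within S))"
  shows "mean_curvature_vector S F x $ a
    = laplace_beltrami S (induced_metric S F) (\<lambda>y. F y $ a) x"
  by (simp add: mean_curvature_vector_def laplace_beltrami_def hessian_component[OF assms(1-3)]
      second_fundamental_form_eq[OF assms])

lemma conormal_derivative_component:
  fixes F :: "real^'k \<Rightarrow> real^'n"
  assumes "openin (top_of_set half_space) S" "x \<in> S" "F differentiable (at x within S)"
  shows "conormal_derivative S g (\<lambda>y. F y $ a) x = conormal_derivative S g F x $ a"
  using frechet_derivative_within_half_space[OF assms(1,2)
      bounded_linear.has_derivative[OF bounded_linear_vec_nth
        frechet_derivative_works[THEN iffD1, OF assms(3)]]]
  by (simp add: conormal_derivative_def)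


section \<open>Free boundary minimal submanifolds of the ball\<close>

theorem lemma2p2:
  fixes X :: "'a topology"
    and A :: "('a, 'k::finite) chart set"
    and \<phi> :: "'a \<Rightarrow> real^'n"
  assumes "smooth_manifold_with_boundary X A"
    and "compact_space X"
    and "mfd_boundary A \<noteq> {}"
    and "properly_immersed_in_ball X A \<phi>"
  shows "minimal_immersion A \<phi> \<and> meets_sphere_orthogonally A \<phi> \<longleftrightarrow>
         (\<forall>i. dtn_eigenfunction A \<phi> 1 (\<lambda>p. \<phi> p $ i))"
proof -
  have coord: "(\<lambda>p. \<phi> p $ a) \<circ> inv_into U c = (\<lambda>y. (\<phi> \<circ> inv_into U c) y $ a)"
    for a and U :: "'a set" and c :: "'a \<Rightarrow> real^'k"
    by (simp add: fun_eq_iff)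
  have S: "openin (top_of_set half_space) (c ` U)" if "(U, c) \<in> A" for U c
    using assms(1) that by (auto simp: smooth_manifold_with_boundary_def chart_of_def)
  have F: "smooth_on (c ` U) (\<phi> \<circ> inv_into U c)"
    and inj: "x \<in> c ` U \<Longrightarrow> inj (frechet_derivative (\<phi> \<circ> inv_into U c) (at x within c ` U))"
    if "(U, c) \<in> A" for U c x
    using assms(4) that by (auto simp: properly_immersed_in_ball_def smooth_immersion_def)
  have charts: "(\<forall>(U, c)\<in>A. P U c) \<longleftrightarrow> (\<forall>U c. (U, c) \<in> A \<longrightarrow> P U c)" for P
    by auto
  have smooth: "smooth_function A (\<lambda>p. \<phi> p $ a)" for a
    using smooth_on_bounded_linear[OF F bounded_linear_vec_nth]
    by (auto simp: smooth_function_def coord)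
  have "minimal_immersion A \<phi> \<longleftrightarrow> (\<forall>a. harmonic A \<phi> (\<lambda>p. \<phi> p $ a))"
  proof -
    have eq: "mean_curvature_vector (c ` U) (\<phi> \<circ> inv_into U c) (c p) = 0 \<longleftrightarrow>
        (\<forall>a. laplace_beltrami (c ` U) (chart_metric \<phi> (U, c)) ((\<lambda>p. \<phi> p $ a) \<circ> inv_into U c) (c p) = 0)"
      if "(U, c) \<in> A" "p \<in> U" for U c p
      using mean_curvature_component_eq_laplacian[OF S[OF that(1)] F[OF that(1)] imageI[OF that(2)]
          inj[OF that(1) imageI[OF that(2)]]]
      by (simp add: vec_eq_iff coord chart_metric_def)
    then show ?thesis
      unfolding minimal_immersion_def harmonic_def charts by (simp add: smooth eq) blast
  qed
  moreover have "meets_sphere_orthogonally A \<phi> \<longleftrightarrow> (\<forall>a. \<forall>(U, c)\<in>A. \<forall>p\<in>U. c p $ bdry_ix = 0 \<longrightarrow>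
      conormal_derivative (c ` U) (chart_metric \<phi> (U, c)) ((\<lambda>p. \<phi> p $ a) \<circ> inv_into U c) (c p)
        = 1 * \<phi> p $ a)"
  proof -
    have eq: "conormal_derivative (c ` U) (chart_metric \<phi> (U, c)) (\<phi> \<circ> inv_into U c) (c p) = \<phi> p \<longleftrightarrow>
        (\<forall>a. conormal_derivative (c ` U) (chart_metric \<phi> (U, c)) ((\<lambda>p. \<phi> p $ a) \<circ> inv_into U c) (c p)
          = 1 * \<phi> p $ a)"
      if "(U, c) \<in> A" "p \<in> U" for U c p
      using conormal_derivative_component[OF S[OF that(1)] imageI[OF that(2)]
          smooth_on_differentiable[OF F[OF that(1)] imageI[OF that(2)]]]
      by (simp add: vec_eq_iff coord)
    then show ?thesis
      unfolding meets_sphere_orthogonally_def charts by (simp add: eq) blast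
  qed
  ultimately show ?thesis
    unfolding dtn_eigenfunction_def dirichlet_to_neumann_def harmonic_extension_def by simp blast
qed

end
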